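(* For every $n\ge 2$, $$B(n)\le\min\Bigl[\tfrac12\bigl(A(n-1,\eta_0)+k(n)\bigr),\;k(n)-2\Bigr],\qquad \eta_0:=\arccos\frac1{\sqrt3}.$$
   Context: $S^{n-1}$ is the unit sphere in $\mathbb R^n$ with angular distance $\operatorname{dist}$, and $e_n=(0,\dots,0,1)$. A finite set $C\subset S^{n-1}$ is a $\theta$-code if $\operatorname{dist}(x,y)\ge\theta$ for all distinct $x,y\in C$. $A(n,\theta)$ is the maximum size of a $\theta$-code in $S^{n-1}$; $k(n)=A(n,\pi/3)$ is the kissing number. The one-sided kissing number $B(n)$ is the maximum size of a $\pi/3$-code contained in the closed hemisphere $\{x\in S^{n-1}:\langle x,e_n\rangle\ge0\}$. *)

theory Defs
  imports Complex_Main "Jordan_Normal_Form.Matrix"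
begin

text \<open>
  The dimension varies inside a single statement, so vectors of dimension n are the elements of
  \<^term>\<open>carrier_vec n\<close>, with \<^const>\<open>scalar_prod\<close> as inner product and coordinates 0, ..., n-1.
  Hence the last standard basis vector is \<^term>\<open>unit_vec n (n - 1)\<close>.
\<close>

text \<open>\<open>unit_sphere n\<close> is the sphere of dimension n-1 in real n-space.\<close>

definition unit_sphere :: "nat \<Rightarrow> real vec set" where
  "unit_sphere n = {x \<in> carrier_vec n. x \<bullet> x = 1}"

definition ang_dist :: "real vec \<Rightarrow> real vec \<Rightarrow> real" where
  "ang_dist x y = arccos (x \<bullet> y)"

definition spherical_code :: "nat \<Rightarrow> real \<Rightarrow> real vec set \<Rightarrow> bool" where
  "spherical_code n \<theta> C \<longleftrightarrow>
     finite C \<and> C \<subseteq> unit_sphere n \<and> (\<forall>x\<in>C. \<forall>y\<in>C. x \<noteq> y \<longrightarrow> ang_dist x y \<ge> \<theta>)"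

text \<open>
  For \<open>\<theta> > 0\<close> the sizes of \<open>\<theta>\<close>-codes are bounded (the sphere is compact), and the empty code has
  size 0, so the maxima below are taken over finite nonempty sets.
\<close>

definition max_code :: "nat \<Rightarrow> real \<Rightarrow> nat" where
  "max_code n \<theta> = Max {card C | C. spherical_code n \<theta> C}"

definition kissing_number :: "nat \<Rightarrow> nat" where
  "kissing_number n = max_code n (pi / 3)"

definition hemisphere :: "nat \<Rightarrow> real vec set" where
  "hemisphere n = {x \<in> unit_sphere n. x \<bullet> unit_vec n (n - 1) \<ge> 0}"

definition one_sided_kissing_number :: "nat \<Rightarrow> nat" where
  "one_sided_kissing_number n = Max {card C | C. spherical_code n (pi / 3) C \<and> C \<subseteq> hemisphere n}"

end

theory Submission
  imports Defs
begin

text \<open>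
  Both bounds come from enlarging a maximal one-sided code \<open>C\<close> to a kissing configuration of the
  whole sphere. Write \<open>h\<close> for the height of a point, its scalar product with the pole \<open>e\<close>.

  For the first bound, reflect in the equator. Since heights in \<open>C\<close> are nonnegative, the mirror
  image of \<open>x\<close> is at least as far from any other point \<open>y\<close> of \<open>C\<close> as \<open>x\<close> is, because the reflection
  lowers the scalar product by \<open>2 h(x) h(y)\<close>. It is far from \<open>x\<close> itself exactly when
  \<open>h(x) \<ge> 1/2\<close>. So the mirror images of the high points may be added, which gives
  \<open>2 |C| \<le> k(n) + |L|\<close> with \<open>L\<close> the set of low points, those of height below \<open>1/2\<close>. Points of \<open>L\<close>
  can be pushed along meridians to the equator: an elementary inequality shows that the
  scalar products are then at most \<open>1/sqrt 3\<close>, the limiting case being one point on the equator and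
  the other of height \<open>1/2\<close>. Hence \<open>|L| \<le> A(n-1, \<eta>\<^sub>0)\<close>.

  For the second bound, two points can be added unconditionally: tilt the south pole by \<open>\<pi>/6\<close> in
  two opposite directions. The two points are \<open>\<pi>/3\<close> apart, and each is at distance at least
  \<open>\<pi>/2 - \<pi>/6\<close> from the closed upper hemisphere.

  To read these inequalities off the definitions, the maxima have to be maxima of
  bounded sets of cardinalities; a pigeonhole argument on a cubical grid provides this.
\<close>

section \<open>Scalar products and codes\<close>

lemma unit_sphereD:
  assumes "x \<in> unit_sphere n"
  shows "x \<in> carrier_vec n" and "x \<bullet> x = 1"
  using assms by (auto simp: unit_sphere_def)

lemma scalar_prod_diff_self:
  fixes x y :: "real vec"
  assumes "x \<in> carrier_vec n" "y \<in> carrier_vec n"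
  shows "(\<Sum>i<n. (x $ i - y $ i)\<^sup>2) = x \<bullet> x - 2 * (x \<bullet> y) + y \<bullet> y"
proof -
  have "(\<Sum>i<n. (x $ i - y $ i)\<^sup>2)
      = (\<Sum>i<n. x $ i * x $ i - 2 * (x $ i * y $ i) + y $ i * y $ i)"
    by (intro sum.cong) (auto simp: power2_eq_square algebra_simps)
  also have "\<dots> = x \<bullet> x - 2 * (x \<bullet> y) + y \<bullet> y"
    using assms
    by (simp add: scalar_prod_def sum.distrib sum_subtractf sum_distrib_left atLeast0LessThan)
  finally show ?thesis .
qed

lemma unit_sphere_scalar_prod_bounds:
  assumes "x \<in> unit_sphere n" "y \<in> unit_sphere n"
  shows "x \<bullet> y \<le> 1" and "-1 \<le> x \<bullet> y"
proof -
  note x = unit_sphereD[OF assms(1)] and y = unit_sphereD[OF assms(2)]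
  have "0 \<le> (\<Sum>i<n. (x $ i - y $ i)\<^sup>2)"
    by (intro sum_nonneg) auto
  then show "x \<bullet> y \<le> 1"
    using scalar_prod_diff_self[OF x(1) y(1)] x(2) y(2) by simp
  have "0 \<le> (\<Sum>i<n. (x $ i - (-y) $ i)\<^sup>2)"
    by (intro sum_nonneg) auto
  then show "-1 \<le> x \<bullet> y"
    using scalar_prod_diff_self[OF x(1) uminus_carrier_vec[THEN iffD2, OF y(1)]] x y by simp
qed

text \<open>
  The rest of the argument is about scalar products only; the bounds above keep them in the range
  in which \<^const>\<open>arccos\<close> is the inverse of \<^const>\<open>cos\<close>.
\<close>

lemma spherical_code_iff_scalar_prod:
  assumes "0 \<le> \<theta>" "\<theta> \<le> pi"
  shows "spherical_code n \<theta> C \<longleftrightarrow>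
    finite C \<and> C \<subseteq> unit_sphere n \<and> (\<forall>x\<in>C. \<forall>y\<in>C. x \<noteq> y \<longrightarrow> x \<bullet> y \<le> cos \<theta>)"
proof -
  have "ang_dist x y \<ge> \<theta> \<longleftrightarrow> x \<bullet> y \<le> cos \<theta>"
    if "x \<in> unit_sphere n" "y \<in> unit_sphere n" for x y
  proof -
    note b = unit_sphere_scalar_prod_bounds[OF that]
    have "ang_dist x y \<ge> \<theta> \<longleftrightarrow> cos (arccos (x \<bullet> y)) \<le> cos \<theta>"
      unfolding ang_dist_def
      using assms b by (subst cos_mono_le_eq) (auto intro: arccos_lbound arccos_ubound)
    then show ?thesis using b by simp
  qed
  then show ?thesis
    unfolding spherical_code_def by blast
qed

lemma spherical_code_Un:
  assumes "spherical_code n \<theta> C" "spherical_code n \<theta> D" "0 \<le> \<theta>" "\<theta> \<le> pi"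
    and cross: "\<And>x y. x \<in> C \<Longrightarrow> y \<in> D \<Longrightarrow> x \<bullet> y \<le> cos \<theta>"
  shows "spherical_code n \<theta> (C \<union> D)"
proof -
  have "y \<bullet> x \<le> cos \<theta>" if "x \<in> C" "y \<in> D" for x y
  proof -
    have "x \<in> carrier_vec n" "y \<in> carrier_vec n"
      using assms(1,2) that by (auto simp: spherical_code_def unit_sphere_def)
    then show ?thesis
      using cross[OF that] comm_scalar_prod[of x n y] by simp
  qed
  then show ?thesis
    using assms by (auto simp: spherical_code_iff_scalar_prod)
qed

section \<open>Boundedness of code sizes\<close>

text \<open>
  Two points in the same cell of the grid of mesh \<open>1/k\<close> differ by less than \<open>1/k\<close> in every
  coordinate, so their squared distance is at most \<open>n/k\<^sup>2\<close>. For \<open>k\<close> large this is less than the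
  squared chord \<open>2 - 2 cos \<theta>\<close>, so each of the finitely many cells contains at most one code point.
\<close>

lemma spherical_code_card_bounded:
  assumes "0 < \<theta>" "\<theta> \<le> pi"
  shows "\<exists>N. \<forall>C. spherical_code n \<theta> C \<longrightarrow> card C \<le> N"
proof -
  have c: "cos \<theta> < 1"
    using assms cos_monotone_0_pi[of 0 \<theta>] by simp
  obtain k0 :: nat where k0: "real n / (2 - 2 * cos \<theta>) < real k0"
    using reals_Archimedean2 by blast
  define k where "k = Suc k0"
  have k1: "real k \<ge> 1" by (simp add: k_def)
  have k: "real n < (2 - 2 * cos \<theta>) * real k"
  proof -
    have "real n / (2 - 2 * cos \<theta>) < real k" using k0 by (simp add: k_def)
    then show ?thesis using c by (simp add: field_simps)
  qed
  define G where "G = ({..<n} \<rightarrow>\<^sub>E {- int k..int k})"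
  define cell where "cell x = restrict (\<lambda>i. \<lfloor>real k * x $ i\<rfloor>) {..<n}" for x :: "real vec"
  have "finite G" by (auto simp: G_def intro: finite_PiE)
  have "card C \<le> card G" if code: "spherical_code n \<theta> C" for C
  proof (rule card_inj_on_le[OF _ _ \<open>finite G\<close>])
    have sub: "C \<subseteq> unit_sphere n" and sep: "\<And>x y. x \<in> C \<Longrightarrow> y \<in> C \<Longrightarrow> x \<noteq> y \<Longrightarrow> x \<bullet> y \<le> cos \<theta>"
      using code assms by (auto simp: spherical_code_iff_scalar_prod)
    show "cell ` C \<subseteq> G"
    proof (rule image_subsetI)
      fix x assume "x \<in> C"
      then have x: "x \<in> carrier_vec n" "x \<bullet> x = 1"
        using sub unit_sphereD by blast+
      have "\<lfloor>real k * x $ i\<rfloor> \<in> {- int k..int k}" if "i < n" for i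
      proof -
        have "(x $ i)\<^sup>2 \<le> (\<Sum>j<n. (x $ j)\<^sup>2)"
          using that by (intro member_le_sum) auto
        also have "\<dots> = 1"
          using x by (simp add: scalar_prod_def power2_eq_square atLeast0LessThan)
        finally have "\<bar>x $ i\<bar> \<le> 1"
          by (simp add: abs_square_le_1)
        then have "real k * x $ i \<le> real k * 1" "real k * (-1) \<le> real k * x $ i"
          by (intro mult_left_mono; simp)+
        then show ?thesis by (auto simp: le_floor_iff floor_le_iff)
      qed
      then show "cell x \<in> G" by (auto simp: cell_def G_def)
    qed
    show "inj_on cell C"
    proof (rule inj_onI, rule ccontr)
      fix x y assume xy: "x \<in> C" "y \<in> C" "cell x = cell y" "x \<noteq> y"
      then have x: "x \<in> carrier_vec n" "x \<bullet> x = 1" and y: "y \<in> carrier_vec n" "y \<bullet> y = 1"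
        using sub unit_sphereD by blast+
      have coord: "(x $ i - y $ i)\<^sup>2 \<le> 1 / (real k)\<^sup>2" if "i < n" for i
      proof -
        have "\<lfloor>real k * x $ i\<rfloor> = \<lfloor>real k * y $ i\<rfloor>"
          using fun_cong[OF xy(3), of i] that by (simp add: cell_def)
        then have "\<bar>real k * (x $ i - y $ i)\<bar> \<le> 1"
          unfolding right_diff_distrib by linarith
        then have "(real k)\<^sup>2 * (x $ i - y $ i)\<^sup>2 \<le> 1"
          unfolding power_mult_distrib[symmetric] abs_square_le_1 .
        then show ?thesis using k1 by (simp add: pos_le_divide_eq mult.commute)
      qed
      have "2 - 2 * cos \<theta> \<le> (\<Sum>i<n. (x $ i - y $ i)\<^sup>2)"
        using sep[OF xy(1,2,4)] scalar_prod_diff_self[OF x(1) y(1)] x y by simp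
      also have "\<dots> \<le> (\<Sum>i<n. 1 / (real k)\<^sup>2)"
        using coord by (intro sum_mono) auto
      also have "\<dots> = real n / (real k)\<^sup>2" by simp
      finally have "(2 - 2 * cos \<theta>) * (real k)\<^sup>2 \<le> real n"
        using k1 by (simp add: field_simps)
      moreover have "(2 - 2 * cos \<theta>) * real k * 1 \<le> (2 - 2 * cos \<theta>) * real k * real k"
        using c k1 by (intro mult_left_mono) auto
      ultimately show False using k by (simp add: power2_eq_square)
    qed
  qed
  then show ?thesis by blast
qed

lemma finite_code_cards:
  assumes "0 < \<theta>" "\<theta> \<le> pi"
  shows "finite {card C | C. spherical_code n \<theta> C}"
proof -
  obtain N where "\<forall>C. spherical_code n \<theta> C \<longrightarrow> card C \<le> N"
    using spherical_code_card_bounded[OF assms] by blast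
  then have "{card C | C. spherical_code n \<theta> C} \<subseteq> {..N}" by auto
  then show ?thesis by (rule finite_subset) simp
qed

lemma card_le_max_code:
  assumes "spherical_code n \<theta> C" "0 < \<theta>" "\<theta> \<le> pi"
  shows "card C \<le> max_code n \<theta>"
  unfolding max_code_def using assms by (intro Max_ge finite_code_cards) auto

lemma one_sided_kissing_number_attained:
  obtains C where "spherical_code n (pi / 3) C" "C \<subseteq> hemisphere n"
    "card C = one_sided_kissing_number n"
proof -
  let ?S = "{card C | C. spherical_code n (pi / 3) C \<and> C \<subseteq> hemisphere n}"
  have "finite ?S"
    by (rule finite_subset[OF _ finite_code_cards[of "pi / 3" n]]) auto
  moreover have "card ({} :: real vec set) \<in> ?S"
    by (fastforce simp: spherical_code_def)
  ultimately have "Max ?S \<in> ?S"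
    by (intro Max_in) auto
  then show ?thesis using that by (auto simp: one_sided_kissing_number_def)
qed

section \<open>Reflection of the high points\<close>

abbreviation pole :: "nat \<Rightarrow> real vec" where
  "pole n \<equiv> unit_vec n (n - 1)"

definition height :: "nat \<Rightarrow> real vec \<Rightarrow> real" where
  "height n x = x $ (n - 1)"

lemma scalar_prod_pole:
  assumes "n \<ge> 1" "x \<in> carrier_vec n"
  shows "x \<bullet> pole n = height n x"
  using assms by (simp add: height_def)

lemma hemisphere_height:
  assumes "n \<ge> 1" "x \<in> hemisphere n"
  shows "height n x \<ge> 0"
  using assms scalar_prod_pole[of n x] by (auto simp: hemisphere_def unit_sphere_def)

definition reflect :: "nat \<Rightarrow> real vec \<Rightarrow> real vec" where
  "reflect n x = x + (- 2 * height n x) \<cdot>\<^sub>v pole n"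

lemma reflect_carrier [simp]: "x \<in> carrier_vec n \<Longrightarrow> reflect n x \<in> carrier_vec n"
  by (simp add: reflect_def)

lemma scalar_prod_reflect:
  assumes "n \<ge> 1" "x \<in> carrier_vec n" "y \<in> carrier_vec n"
  shows "y \<bullet> reflect n x = y \<bullet> x - 2 * height n x * height n y"
  using assms unfolding reflect_def scalar_prod_pole[OF assms(1,3), symmetric]
  by (subst scalar_prod_add_distrib[of _ n]) (auto simp: scalar_prod_smult_distrib[of _ n])

lemma height_reflect:
  assumes "n \<ge> 1" "x \<in> carrier_vec n"
  shows "height n (reflect n x) = - height n x"
  using assms by (simp add: reflect_def height_def)

lemma reflect_scalar_prod_reflect:
  assumes "n \<ge> 1" "x \<in> carrier_vec n" "y \<in> carrier_vec n"
  shows "reflect n x \<bullet> reflect n y = x \<bullet> y"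
proof -
  have "reflect n x \<bullet> reflect n y = reflect n x \<bullet> y + 2 * height n x * height n y"
    using assms by (simp add: scalar_prod_reflect height_reflect)
  also have "reflect n x \<bullet> y = y \<bullet> reflect n x"
    using assms by (intro comm_scalar_prod[of _ n]) auto
  also have "\<dots> = x \<bullet> y - 2 * height n x * height n y"
    using assms comm_scalar_prod[of x n y] by (simp add: scalar_prod_reflect)
  finally show ?thesis by simp
qed

lemma reflect_inj_on:
  assumes "n \<ge> 1"
  shows "inj_on (reflect n) (carrier_vec n)"
proof (rule inj_on_inverseI)
  fix x :: "real vec" assume x: "x \<in> carrier_vec n"
  show "reflect n (reflect n x) = x"
    unfolding reflect_def[of n "reflect n x"] height_reflect[OF assms x]
    using x by (intro eq_vecI) (auto simp: reflect_def)
qed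

lemma reflect_spherical_code:
  assumes "n \<ge> 1" "0 \<le> \<theta>" "\<theta> \<le> pi" "spherical_code n \<theta> C"
  shows "spherical_code n \<theta> (reflect n ` C)"
proof -
  have "C \<subseteq> carrier_vec n"
    using assms(4) by (auto simp: spherical_code_def unit_sphere_def)
  then show ?thesis
    using assms
    by (fastforce simp: spherical_code_iff_scalar_prod unit_sphere_def reflect_scalar_prod_reflect)
qed

text \<open>
  A point of height at least \<open>1/2\<close> makes an angle of at least \<open>\<pi>/6\<close> with the equator, hence of at
  least \<open>\<pi>/3\<close> with its own mirror image, so the images of such points can be added to the code.
\<close>

lemma card_add_card_high_le_kissing_number:
  assumes n: "n \<ge> 1" and code: "spherical_code n (pi / 3) C" and C: "C \<subseteq> hemisphere n"
  shows "card C + card {x \<in> C. height n x \<ge> 1 / 2} \<le> kissing_number n"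
proof -
  define H where "H = {x \<in> C. height n x \<ge> 1 / 2}"
  have fin: "finite C" and car: "\<And>x. x \<in> C \<Longrightarrow> x \<in> carrier_vec n"
    and unit: "\<And>x. x \<in> C \<Longrightarrow> x \<bullet> x = 1"
    and sep: "\<And>x y. x \<in> C \<Longrightarrow> y \<in> C \<Longrightarrow> x \<noteq> y \<Longrightarrow> x \<bullet> y \<le> 1 / 2"
    using code by (auto simp: spherical_code_iff_scalar_prod cos_60 unit_sphere_def)
  have pos: "\<And>x. x \<in> C \<Longrightarrow> height n x \<ge> 0"
    using C hemisphere_height[OF n] by blast
  have "spherical_code n (pi / 3) H"
    using code by (auto simp: H_def spherical_code_def)
  then have "spherical_code n (pi / 3) (reflect n ` H)"
    using n by (intro reflect_spherical_code) auto
  then have "spherical_code n (pi / 3) (C \<union> reflect n ` H)"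
  proof (rule spherical_code_Un[OF code])
    fix y z assume y: "y \<in> C" and "z \<in> reflect n ` H"
    then obtain x where x: "x \<in> C" "height n x \<ge> 1 / 2" "z = reflect n x"
      by (auto simp: H_def)
    have "y \<bullet> z = y \<bullet> x - 2 * (height n x * height n y)"
      using n x y car by (simp add: scalar_prod_reflect)
    also have "\<dots> \<le> 1 / 2"
    proof (cases "x = y")
      case True
      have "1 / 2 * (1 / 2) \<le> height n x * height n x"
        using x by (intro mult_mono) auto
      then show ?thesis using True unit[OF y] by simp
    next
      case False
      have "0 \<le> height n x * height n y"
        using pos x y by simp
      then show ?thesis using False sep[of y x] x y by simp
    qed
    finally show "y \<bullet> z \<le> cos (pi / 3)" by (simp add: cos_60)
  qed auto
  then have "card (C \<union> reflect n ` H) \<le> kissing_number n"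
    unfolding kissing_number_def by (intro card_le_max_code) auto
  moreover have "C \<inter> reflect n ` H = {}"
  proof -
    have "height n (reflect n x) < 0" if "x \<in> H" for x
      using that car n by (auto simp: H_def height_reflect)
    then show ?thesis using pos by force
  qed
  moreover have "card (reflect n ` H) = card H"
    using car by (intro card_image inj_on_subset[OF reflect_inj_on[OF n]]) (auto simp: H_def)
  moreover have "finite H" using fin by (simp add: H_def)
  ultimately show ?thesis
    using fin by (simp add: card_Un_disjoint H_def)
qed

section \<open>Projection of the low points to the equator\<close>

text \<open>
  Two points at heights \<open>a\<close> and \<open>b\<close> whose scalar product is at most \<open>1/2\<close> have, after projection to
  the equator, a scalar product of at most the left-hand side. After squaring, the claim is that
  \<open>1/4 - a\<^sup>2 - b\<^sup>2 + 3 a b - 2 a\<^sup>2 b\<^sup>2\<close> is nonnegative. This is a concave function of \<open>a\<close>, and its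
  values at \<open>a = 0\<close> and \<open>a = 1/2\<close> are \<open>1/4 - b\<^sup>2\<close> and \<open>(3/2) b (1 - b)\<close>.
\<close>

lemma projected_scalar_prod_bound:
  fixes a b :: real
  assumes "0 \<le> a" "a \<le> 1 / 2" "0 \<le> b" "b \<le> 1 / 2"
  shows "(1 / 2 - a * b) / (sqrt (1 - a\<^sup>2) * sqrt (1 - b\<^sup>2)) \<le> 1 / sqrt 3"
proof -
  \<comment> \<open>The interpolation of the two end values plus the concave remainder \<open>(1 + 2 b\<^sup>2) a (1/2 - a)\<close>.\<close>
  have "1 / 4 - a\<^sup>2 - b\<^sup>2 + 3 * (a * b) - 2 * (a\<^sup>2 * b\<^sup>2)
      = (1 - 2 * a) * ((1 / 2 - b) * (1 / 2 + b)) + 2 * a * (3 / 2 * (b * (1 - b)))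
        + (1 + 2 * b\<^sup>2) * (a * (1 / 2 - a))"
    by (simp add: power2_eq_square field_simps)
  also have "\<dots> \<ge> 0"
    using assms by (intro add_nonneg_nonneg mult_nonneg_nonneg) auto
  finally have "3 * (1 / 2 - a * b)\<^sup>2 \<le> (1 - a\<^sup>2) * (1 - b\<^sup>2)"
    by (simp add: power2_eq_square algebra_simps)
  then have "sqrt (3 * (1 / 2 - a * b)\<^sup>2) \<le> sqrt ((1 - a\<^sup>2) * (1 - b\<^sup>2))"
    by (rule real_sqrt_le_mono)
  moreover have "a * b \<le> 1 / 2 * (1 / 2)"
    using assms by (intro mult_mono) auto
  ultimately have *: "sqrt 3 * (1 / 2 - a * b) \<le> sqrt (1 - a\<^sup>2) * sqrt (1 - b\<^sup>2)"
    by (simp add: real_sqrt_mult)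
  have "c\<^sup>2 < 1" if "0 \<le> c" "c \<le> 1 / 2" for c :: real
    using that by (simp add: power2_less_1_iff abs_less_iff)
  then have "0 < sqrt (1 - a\<^sup>2) * sqrt (1 - b\<^sup>2)"
    using assms by simp
  then show ?thesis using * by (simp add: field_simps)
qed

definition equator_proj :: "nat \<Rightarrow> real vec \<Rightarrow> real vec" where
  "equator_proj n x = (1 / sqrt (1 - (height n x)\<^sup>2)) \<cdot>\<^sub>v vec (n - 1) (\<lambda>i. x $ i)"

lemma equator_proj_scalar_prod:
  assumes "n \<ge> 1" "x \<in> carrier_vec n" "y \<in> carrier_vec n"
  shows "equator_proj n x \<bullet> equator_proj n y
    = (x \<bullet> y - height n x * height n y) / (sqrt (1 - (height n x)\<^sup>2) * sqrt (1 - (height n y)\<^sup>2))"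
proof -
  obtain m where m: "n = Suc m" using assms(1) by (cases n) auto
  have "vec m (\<lambda>i. x $ i) \<bullet> vec m (\<lambda>i. y $ i) = x \<bullet> y - height n x * height n y"
    using assms by (simp add: m scalar_prod_def[of _ "vec _ _"] scalar_prod_def[of x y]
        height_def)
  then show ?thesis
    by (simp add: equator_proj_def m smult_scalar_prod_distrib[of _ m]
        scalar_prod_smult_distrib[of _ m])
qed

lemma card_low_le_max_code:
  assumes n: "n \<ge> 1" and code: "spherical_code n (pi / 3) C" and C: "C \<subseteq> hemisphere n"
  shows "card {x \<in> C. height n x < 1 / 2} \<le> max_code (n - 1) (arccos (1 / sqrt 3))"
proof -
  define L where "L = {x \<in> C. height n x < 1 / 2}"
  let ?p = "equator_proj n"
  have fin: "finite L" and car: "\<And>x. x \<in> L \<Longrightarrow> x \<in> carrier_vec n"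
    and unit: "\<And>x. x \<in> L \<Longrightarrow> x \<bullet> x = 1"
    and sep: "\<And>x y. x \<in> L \<Longrightarrow> y \<in> L \<Longrightarrow> x \<noteq> y \<Longrightarrow> x \<bullet> y \<le> 1 / 2"
    using code by (auto simp: L_def spherical_code_iff_scalar_prod cos_60 unit_sphere_def)
  have ht: "0 \<le> height n x" "height n x \<le> 1 / 2" if "x \<in> L" for x
    using C that hemisphere_height[OF n] by (auto simp: L_def)
  have lt: "(height n x)\<^sup>2 < 1" if "x \<in> L" for x
    using ht[OF that] by (simp add: power2_less_1_iff abs_less_iff)
  have one: "?p x \<bullet> ?p x = 1" if "x \<in> L" for x
    using lt[OF that] equator_proj_scalar_prod[OF n car[OF that] car[OF that]] unit[OF that]
    by (simp add: power2_eq_square)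
  have le: "?p x \<bullet> ?p y \<le> 1 / sqrt 3" if "x \<in> L" "y \<in> L" "x \<noteq> y" for x y
  proof -
    have "?p x \<bullet> ?p y \<le> (1 / 2 - height n x * height n y)
        / (sqrt (1 - (height n x)\<^sup>2) * sqrt (1 - (height n y)\<^sup>2))"
      unfolding equator_proj_scalar_prod[OF n car[OF that(1)] car[OF that(2)]]
      using sep[OF that] lt[OF that(1)] lt[OF that(2)]
      by (intro divide_right_mono mult_nonneg_nonneg) auto
    also have "\<dots> \<le> 1 / sqrt 3"
      using ht that by (intro projected_scalar_prod_bound) auto
    finally show ?thesis .
  qed
  have s3: "1 / sqrt 3 < (1 :: real)" "0 < 1 / sqrt (3 :: real)" by auto
  moreover from s3 have "-1 \<le> 1 / sqrt (3 :: real)" by linarith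
  ultimately have \<eta>: "0 < arccos (1 / sqrt 3)" "arccos (1 / sqrt 3) \<le> pi"
      "cos (arccos (1 / sqrt 3)) = 1 / sqrt 3"
    using arccos_less_arccos[of "1 / sqrt 3" 1] arccos_ubound[of "1 / sqrt 3"]
      cos_arccos[of "1 / sqrt 3"] by simp_all
  have "inj_on ?p L"
  proof (rule inj_onI, rule ccontr)
    fix x y assume "x \<in> L" "y \<in> L" "?p x = ?p y" "x \<noteq> y"
    then show False using le[of x y] one[of x] s3(1) by simp
  qed
  then have "card L = card (?p ` L)" by (simp add: card_image)
  also have "spherical_code (n - 1) (arccos (1 / sqrt 3)) (?p ` L)"
    using fin le one \<eta>
    by (auto simp: spherical_code_iff_scalar_prod unit_sphere_def)
      (auto simp: equator_proj_def)
  then have "card (?p ` L) \<le> max_code (n - 1) (arccos (1 / sqrt 3))"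
    using \<eta> by (intro card_le_max_code) auto
  finally show ?thesis by (simp add: L_def)
qed

section \<open>Two tilted south poles\<close>

definition tilted_south_pole :: "nat \<Rightarrow> real \<Rightarrow> real vec" where
  "tilted_south_pole n s = (s / 2) \<cdot>\<^sub>v unit_vec n 0 + (- sqrt 3 / 2) \<cdot>\<^sub>v pole n"

lemma tilted_south_pole_carrier [simp]: "tilted_south_pole n s \<in> carrier_vec n"
  by (simp add: tilted_south_pole_def)

lemma scalar_prod_tilted_south_pole:
  assumes "n \<ge> 1" "x \<in> carrier_vec n"
  shows "x \<bullet> tilted_south_pole n s = s / 2 * x $ 0 - sqrt 3 / 2 * height n x"
  using assms unfolding tilted_south_pole_def scalar_prod_pole[OF assms, symmetric]
  by (subst scalar_prod_add_distrib[of _ n]) (auto simp: scalar_prod_smult_distrib[of _ n])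

text \<open>
  The tilt is along the first coordinate axis, which for \<open>n \<ge> 2\<close> is orthogonal to the pole; this
  is where \<open>n \<ge> 2\<close> enters.
\<close>

lemma tilted_south_pole_coords:
  assumes "n \<ge> 2"
  shows "tilted_south_pole n s $ 0 = s / 2"
    and "height n (tilted_south_pole n s) = - sqrt 3 / 2"
  using assms by (auto simp: tilted_south_pole_def height_def)

lemma one_sided_card_add_2_le_kissing_number:
  assumes n: "n \<ge> 2" and code: "spherical_code n (pi / 3) C" and C: "C \<subseteq> hemisphere n"
  shows "card C + 2 \<le> kissing_number n"
proof -
  let ?t = "tilted_south_pole n"
  have prod: "?t r \<bullet> ?t s = r * s / 4 + 3 / 4" for r s
    using n by (simp add: scalar_prod_tilted_south_pole tilted_south_pole_coords)
  have ne: "?t 1 \<noteq> ?t (-1)"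
    using tilted_south_pole_coords(1)[OF n, of 1] tilted_south_pole_coords(1)[OF n, of "-1"]
    by auto
  have "spherical_code n (pi / 3) {?t 1, ?t (-1)}"
    by (simp add: spherical_code_iff_scalar_prod unit_sphere_def cos_60 prod)
  then have "spherical_code n (pi / 3) (C \<union> {?t 1, ?t (-1)})"
  proof (rule spherical_code_Un[OF code])
    fix x z assume x: "x \<in> C" and "z \<in> {?t 1, ?t (-1)}"
    then obtain s where s: "z = ?t s" "s = 1 \<or> s = -1" by auto
    have xs: "x \<in> unit_sphere n" "height n x \<ge> 0"
      using n C x hemisphere_height[of n x] by (auto simp: hemisphere_def)
    have "unit_vec n 0 \<in> unit_sphere n" "x \<bullet> unit_vec n 0 = x $ 0"
      using n unit_sphereD[OF xs(1)] by (auto simp: unit_sphere_def)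
    then have b: "x $ 0 \<le> 1" "-1 \<le> x $ 0"
      using unit_sphere_scalar_prod_bounds[OF xs(1)] by metis+
    have "x \<bullet> z = s / 2 * x $ 0 - sqrt 3 / 2 * height n x"
      using n s unit_sphereD[OF xs(1)] by (simp add: scalar_prod_tilted_south_pole)
    also have "\<dots> \<le> s / 2 * x $ 0"
      using xs(2) by simp
    also have "\<dots> \<le> 1 / 2"
      using s(2) b by auto
    finally show "x \<bullet> z \<le> cos (pi / 3)" by (simp add: cos_60)
  qed auto
  then have "card (C \<union> {?t 1, ?t (-1)}) \<le> kissing_number n"
    unfolding kissing_number_def by (intro card_le_max_code) auto
  moreover have "C \<inter> {?t 1, ?t (-1)} = {}"
  proof -
    have "height n (?t s) < 0" for s
      using tilted_south_pole_coords(2)[OF n] by simp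
    moreover have "height n x \<ge> 0" if "x \<in> C" for x
      using n C that hemisphere_height[of n x] by auto
    ultimately show ?thesis by (force simp: not_le[symmetric])
  qed
  ultimately show ?thesis
    using code ne by (simp add: card_Un_disjoint spherical_code_def)
qed

section \<open>The bound on the one-sided kissing number\<close>

theorem corollary5:
  fixes n :: nat
  assumes "n \<ge> 2"
  shows "real (one_sided_kissing_number n)
    \<le> min ((1 / 2) * (real (max_code (n - 1) (arccos (1 / sqrt 3))) + real (kissing_number n)))
          (real (kissing_number n) - 2)"
proof -
  obtain C where code: "spherical_code n (pi / 3) C" and C: "C \<subseteq> hemisphere n"
    and card: "card C = one_sided_kissing_number n"
    by (rule one_sided_kissing_number_attained)
  let ?L = "{x \<in> C. height n x < 1 / 2}" and ?H = "{x \<in> C. height n x \<ge> 1 / 2}"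
  have "finite C" using code by (simp add: spherical_code_def)
  then have "card (?L \<union> ?H) = card ?L + card ?H"
    by (intro card_Un_disjoint) auto
  moreover have "?L \<union> ?H = C" by auto
  ultimately have "card C = card ?L + card ?H" by simp
  moreover have "card C + card ?H \<le> kissing_number n"
    using card_add_card_high_le_kissing_number[OF _ code C] assms by simp
  moreover have "card ?L \<le> max_code (n - 1) (arccos (1 / sqrt 3))"
    using card_low_le_max_code[OF _ code C] assms by simp
  ultimately have "2 * card C \<le> max_code (n - 1) (arccos (1 / sqrt 3)) + kissing_number n"
    by linarith
  moreover have "card C + 2 \<le> kissing_number n"
    using one_sided_card_add_2_le_kissing_number[OF assms code C] .
  ultimately show ?thesis
    unfolding card[symmetric] by simp
qed

end
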